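(* Let $\mathcal{X}$ be any domain, $\mathcal{D}$ a distribution over $\mathcal{X}$, and $\mathcal{C}$ a class of concepts $\mathcal{X}\to\{\pm1\}$ closed under complement (if $f\in\mathcal{C}$ then $-f\in\mathcal{C}$). Then for any $\eta\in(0,1/2)$, any $\epsilon\in(0,\eta/2)$ and any $\delta\in(0,1/3)$, no TDS learning algorithm for $\mathcal{C}$ w.r.t. $\mathcal{D}$ with finite sample complexity and failure probability $\delta$ can have error guarantee $\lambda(1-2\eta)+\epsilon$, i.e., achieve test error at most $\lambda(1-2\eta)+\epsilon$ upon acceptance.
   Context: For distributions $\mathcal{D}^{\mathrm{train}}_{\mathcal{XY}},\mathcal{D}^{\mathrm{test}}_{\mathcal{XY}}$ over $\mathcal{X}\times\{\pm1\}$, $\mathrm{err}(h;\mathcal{D}_{\mathcal{XY}})=\Pr[y\ne h(\mathbf{x})]$ and $\lambda=\min_{f\in\mathcal{C}}\{\mathrm{err}(f;\mathcal{D}^{\mathrm{train}}_{\mathcal{XY}})+\mathrm{err}(f;\mathcal{D}^{\mathrm{test}}_{\mathcal{XY}})\}$. A TDS learning algorithm w.r.t. $\mathcal{D}$ with error guarantee $\psi(\lambda)+\epsilon$ and failure probability $\delta$ receives labelled i.i.d. samples from $\mathcal{D}^{\mathrm{train}}_{\mathcal{XY}}$ (whose marginal is $\mathcal{D}$) and unlabelled i.i.d. samples from the test marginal, and rejects or accepts with output $h$, such that for all such pairs of distributions: with probability $\ge1-\delta$, acceptance implies $\mathrm{err}(h;\mathcal{D}^{\mathrm{test}}_{\mathcal{XY}})\le\psi(\lambda)+\epsilon$;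 and if the test marginal equals $\mathcal{D}$ it accepts with probability $\ge1-\delta$. *)

theory Defs
  imports "HOL-Probability.Probability"
begin

text \<open>
  The domain, together with its sigma-algebra, is carried by the reference distribution \<open>D\<close>:
  it is \<open>space D\<close>.  Labels are the integers \<open>-1\<close> and \<open>1\<close>.
\<close>

definition labels :: "int measure" where
  "labels = count_space {-1, 1}"

definition hypotheses :: "'a measure \<Rightarrow> ('a \<Rightarrow> int) set" where
  "hypotheses D = D \<rightarrow>\<^sub>M labels"

definition closed_under_complement :: "('a \<Rightarrow> int) set \<Rightarrow> bool" where
  "closed_under_complement C \<longleftrightarrow> (\<forall>f\<in>C. (\<lambda>x. - f x) \<in> C)"

text \<open>Only the measurable structure of \<open>D\<close> is used here, not its values.\<close>

definition labelled_distribution :: "'a measure \<Rightarrow> ('a \<times> int) measure \<Rightarrow> bool" where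
  "labelled_distribution D Q \<longleftrightarrow> prob_space Q \<and> sets Q = sets (D \<Otimes>\<^sub>M labels)"

definition marginal :: "'a measure \<Rightarrow> ('a \<times> int) measure \<Rightarrow> 'a measure" where
  "marginal D Q = distr Q D fst"

definition err :: "('a \<Rightarrow> int) \<Rightarrow> ('a \<times> int) measure \<Rightarrow> real" where
  "err h Q = \<P>(z in Q. snd z \<noteq> h (fst z))"

text \<open>The infimum is the minimum whenever the latter is attained.\<close>

definition opt_joint_err ::
  "('a \<Rightarrow> int) set \<Rightarrow> ('a \<times> int) measure \<Rightarrow> ('a \<times> int) measure \<Rightarrow> real" where
  "opt_joint_err C Qtrain Qtest = (INF f\<in>C. err f Qtrain + err f Qtest)"

text \<open>
  Joint law of \<open>m\<close> i.i.d. labelled training examples, \<open>n\<close> i.i.d. unlabelled test examples and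
  the internal randomness of the algorithm, which is drawn from \<open>R\<close>.
\<close>

definition run_space ::
  "'r measure \<Rightarrow> nat \<Rightarrow> nat \<Rightarrow> 'a measure \<Rightarrow> ('a \<times> int) measure \<Rightarrow> ('a \<times> int) measure \<Rightarrow>
    ((nat \<Rightarrow> 'a \<times> int) \<times> (nat \<Rightarrow> 'a) \<times> 'r) measure" where
  "run_space R m n D Qtrain Qtest =
    (\<Pi>\<^sub>M i\<in>{..<m}. Qtrain) \<Otimes>\<^sub>M ((\<Pi>\<^sub>M i\<in>{..<n}. marginal D Qtest) \<Otimes>\<^sub>M R)"

text \<open>
  \<open>None\<close> means rejection and \<open>Some h\<close> means acceptance with output \<open>h\<close>.  The output has to be a
  measurable \<open>\<plusminus>1\<close>-valued function: otherwise \<open>err\<close> could be \<open>0\<close> merely because a non-measurable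
  set has \<open>measure\<close> zero.  By the same convention, for \<open>\<delta> < 1\<close> the two
  probability bounds entail that the events in question are measurable.
\<close>

definition tds_learner ::
  "'a measure \<Rightarrow> ('a \<Rightarrow> int) set \<Rightarrow> (real \<Rightarrow> real) \<Rightarrow> real \<Rightarrow> real \<Rightarrow> 'r measure \<Rightarrow> nat \<Rightarrow> nat \<Rightarrow>
    ((nat \<Rightarrow> 'a \<times> int) \<times> (nat \<Rightarrow> 'a) \<times> 'r \<Rightarrow> ('a \<Rightarrow> int) option) \<Rightarrow> bool" where
  "tds_learner D C \<psi> \<epsilon> \<delta> R m n A \<longleftrightarrow>
    prob_space R \<and>
    (\<forall>\<omega> \<in> space ((\<Pi>\<^sub>M i\<in>{..<m}. D \<Otimes>\<^sub>M labels) \<Otimes>\<^sub>M ((\<Pi>\<^sub>M i\<in>{..<n}. D) \<Otimes>\<^sub>M R)).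
      \<forall>h. A \<omega> = Some h \<longrightarrow> h \<in> hypotheses D) \<and>
    (\<forall>Qtrain Qtest.
      labelled_distribution D Qtrain \<and> marginal D Qtrain = D \<and> labelled_distribution D Qtest \<longrightarrow>
      \<P>(\<omega> in run_space R m n D Qtrain Qtest.
        \<forall>h. A \<omega> = Some h \<longrightarrow> err h Qtest \<le> \<psi> (opt_joint_err C Qtrain Qtest) + \<epsilon>) \<ge> 1 - \<delta> \<and>
      (marginal D Qtest = D \<longrightarrow>
        \<P>(\<omega> in run_space R m n D Qtrain Qtest. A \<omega> \<noteq> None) \<ge> 1 - \<delta>))"

end

theory Submission
  imports Defs
begin

text \<open>
  Label the training data by some \<open>f \<in> C\<close> and the test data either by \<open>f\<close> or by \<open>-f\<close>, over the same
  marginal \<open>D\<close>.  The algorithm sees the same data in both cases.  In the first case \<open>\<lambda> = 0\<close>, so that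
  an accepted \<open>h\<close> disagrees with \<open>f\<close> with probability at most \<open>\<epsilon>\<close>; in the second \<open>\<lambda> = 1\<close>, so that it
  agrees with \<open>f\<close> with probability at most \<open>1 - 2\<eta> + \<epsilon>\<close>.  As \<open>2\<epsilon> < 2\<eta>\<close>, no \<open>h\<close> does both, whereas the
  two correctness events and acceptance hold simultaneously with probability at least \<open>1 - 3\<delta> > 0\<close>.
\<close>

definition labelled_by :: "'a measure \<Rightarrow> ('a \<Rightarrow> int) \<Rightarrow> ('a \<times> int) measure" where
  "labelled_by D f = distr D (D \<Otimes>\<^sub>M labels) (\<lambda>x. (x, f x))"

lemma hypotheses_uminus:
  assumes "f \<in> hypotheses D"
  shows "(\<lambda>x. - f x) \<in> hypotheses D"
proof -
  have "uminus \<in> labels \<rightarrow>\<^sub>M labels"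
    by (auto simp: labels_def)
  from measurable_compose[OF _ this] assms show ?thesis
    by (auto simp: hypotheses_def)
qed

lemma hypotheses_range:
  assumes "f \<in> hypotheses D" "x \<in> space D"
  shows "f x = -1 \<or> f x = 1"
  using measurable_space[of f D labels x] assms by (auto simp: hypotheses_def labels_def)

text \<open>Passing to the discrete space on all integers lets the measurability prover treat
  comparisons such as \<open>f x \<noteq> h x\<close> as predicates on a countable type.\<close>

lemma measurable_hypothesis_count_space:
  assumes "f \<in> hypotheses D"
  shows "f \<in> D \<rightarrow>\<^sub>M count_space UNIV"
  using assms measurable_compose[of f D labels "\<lambda>y. y" "count_space UNIV"]
  by (simp add: hypotheses_def labels_def)

lemma measurable_pair_hypothesis:
  assumes "f \<in> hypotheses D"
  shows "(\<lambda>x. (x, f x)) \<in> D \<rightarrow>\<^sub>M D \<Otimes>\<^sub>M labels"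
  using assms by (simp add: hypotheses_def)

lemma space_labelled_by: "space (labelled_by D f) = space (D \<Otimes>\<^sub>M labels)"
  by (simp add: labelled_by_def)

lemma labelled_distribution_labelled_by:
  assumes "prob_space D" "f \<in> hypotheses D"
  shows "labelled_distribution D (labelled_by D f)"
  using prob_space.prob_space_distr[OF assms(1) measurable_pair_hypothesis[OF assms(2)]]
  by (simp add: labelled_distribution_def labelled_by_def)

lemma marginal_labelled_by:
  assumes "f \<in> hypotheses D"
  shows "marginal D (labelled_by D f) = D"
  using measurable_pair_hypothesis[OF assms]
  by (simp add: marginal_def labelled_by_def distr_distr comp_def)

lemma err_labelled_by:
  assumes f: "f \<in> hypotheses D" and h: "h \<in> hypotheses D"
  shows "err h (labelled_by D f) = \<P>(x in D. f x \<noteq> h x)"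
proof -
  note [measurable] = measurable_hypothesis_count_space[OF h]
  have [measurable]: "(\<lambda>y. y) \<in> labels \<rightarrow>\<^sub>M count_space UNIV"
    by (simp add: labels_def)
  have "{z \<in> space (D \<Otimes>\<^sub>M labels). snd z \<noteq> h (fst z)} \<in> sets (D \<Otimes>\<^sub>M labels)"
    by measurable
  then have "err h (labelled_by D f) =
      measure D ((\<lambda>x. (x, f x)) -` {z \<in> space (D \<Otimes>\<^sub>M labels). snd z \<noteq> h (fst z)} \<inter> space D)"
    unfolding err_def labelled_by_def
    using measure_distr[OF measurable_pair_hypothesis[OF f]] by simp
  also have "(\<lambda>x. (x, f x)) -` {z \<in> space (D \<Otimes>\<^sub>M labels). snd z \<noteq> h (fst z)} \<inter> space D =
      {x \<in> space D. f x \<noteq> h x}"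
    using measurable_space[OF measurable_pair_hypothesis[OF f]] by auto
  finally show ?thesis .
qed

text \<open>With only two labels, \<open>h\<close> differs from \<open>-f\<close> exactly where it
  agrees with \<open>f\<close>, so the two error events are complementary in
  \<open>D\<close>.\<close>

lemma err_labelled_by_uminus:
  assumes "prob_space D" and f: "f \<in> hypotheses D" and h: "h \<in> hypotheses D"
  shows "err h (labelled_by D (\<lambda>x. - f x)) = 1 - err h (labelled_by D f)"
proof -
  interpret prob_space D by fact
  note [measurable] = measurable_hypothesis_count_space[OF f] measurable_hypothesis_count_space[OF h]
  have "{x \<in> space D. f x \<noteq> h x} \<in> sets D"
    by measurable
  from prob_compl[OF this]
  have "measure D (space D - {x \<in> space D. f x \<noteq> h x}) = 1 - \<P>(x in D. f x \<noteq> h x)" .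
  moreover have "space D - {x \<in> space D. f x \<noteq> h x} = {x \<in> space D. - f x \<noteq> h x}"
    using hypotheses_range[OF f] hypotheses_range[OF h] by fastforce
  ultimately show ?thesis
    by (simp add: err_labelled_by hypotheses_uminus f h)
qed

text \<open>The labelling function \<open>f\<close> is itself in \<open>C\<close> and errs on
  neither distribution; no sum of errors is negative.\<close>

lemma opt_joint_err_realizable:
  assumes "C \<subseteq> hypotheses D" "f \<in> C"
  shows "opt_joint_err C (labelled_by D f) (labelled_by D f) = 0"
proof -
  have f: "f \<in> hypotheses D"
    using assms by auto
  have "opt_joint_err C (labelled_by D f) (labelled_by D f) \<le>
      err f (labelled_by D f) + err f (labelled_by D f)"
    unfolding opt_joint_err_def
    by (intro cINF_lower bdd_belowI2[where m=0] \<open>f \<in> C\<close>) (simp add: err_def)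
  also have "\<dots> = 0"
    by (simp add: err_labelled_by f)
  finally have "opt_joint_err C (labelled_by D f) (labelled_by D f) \<le> 0" .
  moreover have "0 \<le> opt_joint_err C (labelled_by D f) (labelled_by D f)"
    unfolding opt_joint_err_def using assms by (intro cINF_greatest) (auto simp: err_def)
  ultimately show ?thesis by simp
qed

text \<open>Each \<open>g\<close> errs on exactly one of the two labellings at every point, so the
  infimum is over a constant family; \<open>C\<close> must be nonempty for it to equal that
  constant.\<close>

lemma opt_joint_err_uminus:
  assumes "prob_space D" "C \<subseteq> hypotheses D" "C \<noteq> {}" "f \<in> hypotheses D"
  shows "opt_joint_err C (labelled_by D f) (labelled_by D (\<lambda>x. - f x)) = 1"
proof -
  have "err g (labelled_by D f) + err g (labelled_by D (\<lambda>x. - f x)) = 1" if "g \<in> C" for g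
    using that assms by (subst err_labelled_by_uminus) auto
  then show ?thesis
    using \<open>C \<noteq> {}\<close> by (simp add: opt_joint_err_def)
qed

lemma prob_space_run_space:
  assumes "prob_space R" "prob_space Qtrain" "prob_space (marginal D Qtest)"
  shows "prob_space (run_space R m n D Qtrain Qtest)"
  unfolding run_space_def
  by (intro prob_space_pair prob_space_PiM assms)

text \<open>Test data enter a run only through their marginal, which is \<open>D\<close> for every
  labelling. This is the indistinguishability behind the lower bound.\<close>

lemma run_space_labelled_by_cong:
  assumes "f \<in> hypotheses D" "g \<in> hypotheses D"
  shows "run_space R m n D Q (labelled_by D f) = run_space R m n D Q (labelled_by D g)"
  by (simp add: run_space_def marginal_labelled_by assms)

lemma space_run_space_labelled_by:
  assumes "f \<in> hypotheses D" "g \<in> hypotheses D"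
  shows "space (run_space R m n D (labelled_by D f) (labelled_by D g)) =
    space ((\<Pi>\<^sub>M i\<in>{..<m}. D \<Otimes>\<^sub>M labels) \<Otimes>\<^sub>M ((\<Pi>\<^sub>M i\<in>{..<n}. D) \<Otimes>\<^sub>M R))"
  by (simp add: run_space_def marginal_labelled_by assms space_labelled_by space_pair_measure space_PiM)

text \<open>Union bound: the three complements have total probability at most
  \<open>3 * \<delta> < 1\<close>, so they cannot cover the space.\<close>

lemma (in prob_space) three_likely_events_meet:
  assumes "prob A \<ge> 1 - \<delta>" "prob B \<ge> 1 - \<delta>" "prob C \<ge> 1 - \<delta>" "\<delta> < 1 / 3"
  shows "A \<inter> B \<inter> C \<noteq> {}"
proof
  assume empty: "A \<inter> B \<inter> C = {}"
  have pos: "prob A > 0" "prob B > 0" "prob C > 0"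
    using assms by auto
  \<comment> \<open>A non-measurable set has \<open>measure\<close> 0 by convention, so positive
    probability forces measurability.\<close>
  then have sets: "A \<in> events" "B \<in> events" "C \<in> events"
    by (metis less_irrefl measure_notin_sets)+
  have "space M = (space M - A) \<union> (space M - B) \<union> (space M - C)"
    using empty by auto
  then have "1 = prob ((space M - A) \<union> (space M - B) \<union> (space M - C))"
    using prob_space by simp
  also have "\<dots> \<le> prob ((space M - A) \<union> (space M - B)) + prob (space M - C)"
    by (intro measure_Un_le) (use sets in auto)
  also have "\<dots> \<le> prob (space M - A) + prob (space M - B) + prob (space M - C)"
    by (intro add_right_mono measure_Un_le) (use sets in auto)
  also have "\<dots> \<le> 3 * \<delta>"
    using assms sets by (simp add: prob_compl)
  finally show False
    using assms by simp
qed

theorem theorem2p13: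
  fixes D :: "'a measure" and C :: "('a \<Rightarrow> int) set" and \<eta> \<epsilon> \<delta> :: real
  assumes "prob_space D"
    and "C \<subseteq> hypotheses D" and "C \<noteq> {}"
    and "closed_under_complement C"
    and "0 < \<eta>" and "\<eta> < 1 / 2"
    and "0 < \<epsilon>" and "\<epsilon> < \<eta> / 2"
    and "0 < \<delta>" and "\<delta> < 1 / 3"
  shows "\<not> (\<exists>(R :: 'r measure) m n A. tds_learner D C (\<lambda>l. l * (1 - 2 * \<eta>)) \<epsilon> \<delta> R m n A)"
proof
  assume "\<exists>(R :: 'r measure) m n A. tds_learner D C (\<lambda>l. l * (1 - 2 * \<eta>)) \<epsilon> \<delta> R m n A"
  then obtain R :: "'r measure" and m n A
    where learner: "tds_learner D C (\<lambda>l. l * (1 - 2 * \<eta>)) \<epsilon> \<delta> R m n A" by blast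
  obtain f where "f \<in> C"
    using \<open>C \<noteq> {}\<close> by blast
  then have f: "f \<in> hypotheses D"
    using \<open>C \<subseteq> hypotheses D\<close> by blast
  note f' = hypotheses_uminus[OF f]
  define P where "P = labelled_by D f"
  define N where "N = labelled_by D (\<lambda>x. - f x)"
  define M where "M = run_space R m n D P P"
  \<comment> \<open>Accepted outputs must be hypotheses on all of \<open>space M\<close>, since the
    complementarity of errors is available only for those.\<close>
  have "prob_space R"
    and hyp: "\<And>\<omega> h. \<omega> \<in> space M \<Longrightarrow> A \<omega> = Some h \<Longrightarrow> h \<in> hypotheses D"
    using learner unfolding tds_learner_def M_def P_def space_run_space_labelled_by[OF f f] by blast+
  have P: "labelled_distribution D P" "marginal D P = D" and N: "labelled_distribution D N"
    unfolding P_def N_def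
    by (intro labelled_distribution_labelled_by marginal_labelled_by f f' assms)+
  \<comment> \<open>This puts the guarantees for the test distributions \<open>P\<close> and
    \<open>N\<close> on one probability space, so their events can be intersected.\<close>
  have M_N: "run_space R m n D P N = M"
    unfolding M_def P_def N_def by (rule run_space_labelled_by_cong[OF f' f])
  interpret M: prob_space M
    unfolding M_def using P \<open>prob_space R\<close> \<open>prob_space D\<close>
    by (intro prob_space_run_space) (auto simp: labelled_distribution_def)
  have correct: "\<P>(\<omega> in run_space R m n D P Q. \<forall>h. A \<omega> = Some h \<longrightarrow>
      err h Q \<le> opt_joint_err C P Q * (1 - 2 * \<eta>) + \<epsilon>) \<ge> 1 - \<delta>"
    if "labelled_distribution D Q" for Q
    using learner P that unfolding tds_learner_def by blast
  have "\<P>(\<omega> in M. \<forall>h. A \<omega> = Some h \<longrightarrow> err h P \<le> \<epsilon>) \<ge> 1 - \<delta>"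
    using correct[OF P(1)] opt_joint_err_realizable[OF \<open>C \<subseteq> hypotheses D\<close> \<open>f \<in> C\<close>]
    by (simp add: M_def P_def)
  moreover have "\<P>(\<omega> in M. \<forall>h. A \<omega> = Some h \<longrightarrow> err h N \<le> 1 - 2 * \<eta> + \<epsilon>) \<ge> 1 - \<delta>"
    using correct[OF N] opt_joint_err_uminus[OF assms(1-3) f]
    by (simp add: M_N flip: P_def N_def)
  moreover have "\<P>(\<omega> in M. A \<omega> \<noteq> None) \<ge> 1 - \<delta>"
    using learner P unfolding tds_learner_def M_def by blast
  ultimately obtain \<omega> h where "\<omega> \<in> space M" "A \<omega> = Some h"
    and small: "err h P \<le> \<epsilon>" "err h N \<le> 1 - 2 * \<eta> + \<epsilon>"
    using M.three_likely_events_meet[OF _ _ _ \<open>\<delta> < 1 / 3\<close>] by blast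
  have "err h N = 1 - err h P"
    unfolding N_def P_def
    using hyp[OF \<open>\<omega> \<in> space M\<close> \<open>A \<omega> = Some h\<close>]
    by (rule err_labelled_by_uminus[OF \<open>prob_space D\<close> f])
  \<comment> \<open>Here \<open>1 - \<epsilon> \<le> err h N \<le> 1 - 2 * \<eta> +
    \<epsilon>\<close>, which would give \<open>\<eta> \<le> \<epsilon>\<close>.\<close>
  with small \<open>0 < \<eta>\<close> \<open>\<epsilon> < \<eta> / 2\<close> show False
    by linarith
qed

end
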